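(* Let $(T_a)_{a\in A}$ be a family of positive numbers and let $C$ be the unital cone generated by the set $$S=\{(T_a-a)^j(T_a+a)^k: a\in A,\ j,k\in\mathbb Z_{\ge 0}\}\cup\{(T_b^2-b^2)(T_a-a)^j(T_a+a)^k: a,b\in A,\ j,k\in\mathbb Z_{\ge 0}\}.$$ Let $K=\{\alpha\in X(A):|\alpha(a)|\le T_a\text{ for all }a\in A\}$ and let $c\in A$. If $\alpha(c)>0$ for every $\alpha\in K$, then $c\in C$.
   Context: $A$ is a unital commutative $\mathbb R$-algebra and $X(A)$ is the set of all (unital) $\mathbb R$-algebra homomorphisms $A\to\mathbb R$, assumed non-empty and endowed with the topology of pointwise convergence. Real numbers are regarded as elements of $A$ via $\lambda\mapsto\lambda\cdot 1$. A set $C\subseteq A$ is a cone if $C+C\subseteq C$ and $\lambda C\subseteq C$ for every real $\lambda\ge 0$; the unital cone generated by $S$ is the smallest cone containing $S\cup\{1\}$. *)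

theory Defs
  imports Complex_Main
begin

text \<open>
  The unital real algebra \<open>A\<close> is a type of sort \<open>{comm_ring_1, real_algebra_1}\<close>. This sort
  includes \<open>0 \<noteq> 1\<close>, which costs no generality, as it follows from the existence of a character.
\<close>

definition characters :: "('a::{comm_ring_1, real_algebra_1} \<Rightarrow> real) set" where
  "characters = {\<alpha>. linear \<alpha> \<and> (\<forall>x y. \<alpha> (x * y) = \<alpha> x * \<alpha> y) \<and> \<alpha> 1 = 1}"

text \<open>Unlike the library's \<open>cone\<close> of \<open>HOL-Analysis\<close>, a cone is also closed under addition.\<close>

definition is_cone :: "'a::real_vector set \<Rightarrow> bool" where
  "is_cone C \<longleftrightarrow> (\<forall>x\<in>C. \<forall>y\<in>C. x + y \<in> C) \<and> (\<forall>r\<ge>0. \<forall>x\<in>C. r *\<^sub>R x \<in> C)"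

text \<open>
  The operator \<open>hull\<close> is the intersection of all cones containing the given set. Cones are
  closed under intersection, so this is the smallest such cone.
\<close>

definition unital_cone_generated :: "'a::real_algebra_1 set \<Rightarrow> 'a set" where
  "unital_cone_generated S = is_cone hull (S \<union> {1})"

lemma is_cone_unital_cone_generated: "is_cone (unital_cone_generated S)"
  unfolding unital_cone_generated_def
  by (rule hull_in) (auto simp: is_cone_def)

definition generators :: "('a::{comm_ring_1, real_algebra_1} \<Rightarrow> real) \<Rightarrow> 'a set" where
  "generators T =
     {(of_real (T a) - a) ^ j * (of_real (T a) + a) ^ k | a j k. True} \<union>
     {(of_real ((T b)\<^sup>2) - b\<^sup>2) * (of_real (T a) - a) ^ j * (of_real (T a) + a) ^ k | a b j k. True}"

end

theory Submission imports Defs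
begin

text \<open>
  Suppose \<open>c \<notin> C\<close>. Every \<open>T a + a\<close> lies in \<open>C\<close>, so \<open>1\<close> is an order unit of this cone, and a
  separation argument (\<open>archimedean_cone_separation\<close>) gives a linear functional \<open>L\<close> that is
  nonnegative on \<open>C\<close> with \<open>L 1 = 1\<close> and \<open>L c \<le> 0\<close>. The idea is that \<open>L\<close> must behave like integration
  against a probability measure on \<open>K\<close>, which contradicts \<open>c > 0\<close> on \<open>K\<close>. Two facts make this precise.

  First, for fixed \<open>a\<close> the products \<open>(T a - a) ^ j * (T a + a) ^ k\<close> are, up to a scaling, the
  Bernstein polynomials in \<open>a\<close> on the interval \<open>[-T a, T a]\<close>. Since \<open>L\<close> is nonnegative on all of them,
  it is nonnegative on polynomials in \<open>a\<close> that are nonnegative on this interval; what is used is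
  \<open>L (a\<^sup>2) \<ge> 0\<close> and \<open>L (a ^ (2 * n)) \<le> T a ^ (2 * n)\<close> (\<open>growth_functional_of_generators\<close>).
  Although each generator involves powers of a single element, both facts hold for every \<open>a\<close> in the
  algebra, so \<open>L\<close> is positive semidefinite and the moments of each \<open>a\<close> grow at most like the powers
  of \<open>T a\<close>.

  Second, let \<open>P\<close> be the set of elements on which all functionals with these two properties (up to a
  constant factor in the growth bound) are nonnegative. By the Cauchy-Schwarz inequality the class
  of these functionals is stable under \<open>F \<mapsto> F (p * _)\<close> for \<open>p \<in> P\<close>, so that \<open>P\<close> is a preordering
  (\<open>is_preordering_growth_positive\<close>), and it contains \<open>T b + b\<close> and \<open>T b - b\<close>
  (\<open>growth_functional_bound\<close>). Hence the characters that are nonnegative on \<open>P\<close> belong to \<open>K\<close>, where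
  \<open>c\<close> is positive, and the \<open>archimedean_Positivstellensatz\<close> yields \<open>c - d \<in> P\<close> for some real \<open>d > 0\<close>.
  Now \<open>L c \<ge> d > 0\<close>, a contradiction.
\<close>

section \<open>Maximal cones\<close>

text \<open>
  Both cones and preorderings are the sets closed under some family of binary operations; in this
  form one application of Zorn's lemma serves for both.
\<close>

definition closed_under :: "('b \<Rightarrow> 'b \<Rightarrow> 'b) set \<Rightarrow> 'b set \<Rightarrow> bool" where
  "closed_under Ops M \<longleftrightarrow> (\<forall>f\<in>Ops. \<forall>x\<in>M. \<forall>y\<in>M. f x y \<in> M)"

lemma maximal_closed_set_avoiding:
  assumes closed: "closed_under Ops M0" and avoid: "z \<notin> M0"
  obtains M where "M0 \<subseteq> M" "z \<notin> M" "closed_under Ops M"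
    "\<And>N. M \<subseteq> N \<Longrightarrow> closed_under Ops N \<Longrightarrow> z \<notin> N \<Longrightarrow> N = M"
proof -
  define F where "F = {M. M0 \<subseteq> M \<and> z \<notin> M \<and> closed_under Ops M}"
  have ne: "F \<noteq> {}" using closed avoid unfolding F_def by blast
  have un: "\<Union>\<C> \<in> F" if "\<C> \<noteq> {}" and ch: "subset.chain F \<C>" for \<C>
  proof -
    have sub: "\<C> \<subseteq> F" using ch by (simp add: subset.chain_def)
    have "f x y \<in> \<Union>\<C>" if f: "f \<in> Ops" and xy: "x \<in> \<Union>\<C>" "y \<in> \<Union>\<C>" for f x y
    proof -
      obtain X Y where XY: "X \<in> \<C>" "x \<in> X" "Y \<in> \<C>" "y \<in> Y" using xy by blast
      have "X \<subseteq> Y \<or> Y \<subseteq> X" using ch XY by (auto simp: subset.chain_def)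
      then obtain Z where "Z \<in> \<C>" "x \<in> Z" "y \<in> Z" using XY by blast
      then show ?thesis using sub f unfolding F_def closed_under_def by blast
    qed
    moreover have "M0 \<subseteq> \<Union>\<C>" using that(1) sub unfolding F_def by blast
    moreover have "z \<notin> \<Union>\<C>" using sub unfolding F_def by blast
    ultimately show ?thesis unfolding F_def closed_under_def by blast
  qed
  obtain M where "M \<in> F" "\<forall>X\<in>F. M \<subseteq> X \<longrightarrow> X = M"
    using subset_Zorn_nonempty[OF ne un] by blast
  then show ?thesis using that[of M] unfolding F_def by blast
qed

definition archimedean :: "'a::real_algebra_1 set \<Rightarrow> bool" where
  "archimedean M \<longleftrightarrow> (\<forall>x. \<exists>r. of_real r + x \<in> M)"

lemma is_cone_add: "is_cone M \<Longrightarrow> x \<in> M \<Longrightarrow> y \<in> M \<Longrightarrow> x + y \<in> M"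
  by (simp add: is_cone_def)

lemma is_cone_scale: "is_cone M \<Longrightarrow> 0 \<le> r \<Longrightarrow> x \<in> M \<Longrightarrow> r *\<^sub>R x \<in> M"
  by (simp add: is_cone_def)

lemma is_cone_scale_of_real:
  fixes x :: "'a::real_algebra_1"
  shows "is_cone M \<Longrightarrow> 0 \<le> r \<Longrightarrow> x \<in> M \<Longrightarrow> of_real r * x \<in> M"
  using is_cone_scale[of M r x] by (simp add: scaleR_conv_of_real)

lemma is_cone_of_real:
  fixes M :: "'a::real_algebra_1 set"
  shows "is_cone M \<Longrightarrow> 1 \<in> M \<Longrightarrow> 0 \<le> r \<Longrightarrow> of_real r \<in> M"
  using is_cone_scale_of_real[of M r 1] by simp

lemma archimedean_mono: "archimedean M \<Longrightarrow> M \<subseteq> N \<Longrightarrow> archimedean N"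
  unfolding archimedean_def by blast

definition cone_ops :: "('a::real_vector \<Rightarrow> 'a \<Rightarrow> 'a) set" where
  "cone_ops = {\<lambda>x y. r *\<^sub>R x + s *\<^sub>R y | r s. 0 \<le> r \<and> 0 \<le> s}"

lemma is_cone_iff_closed: "is_cone M \<longleftrightarrow> closed_under cone_ops M"
proof
  assume "is_cone M"
  then show "closed_under cone_ops M"
    by (auto simp: closed_under_def cone_ops_def intro!: is_cone_add is_cone_scale)
next
  assume closed: "closed_under cone_ops M"
  have comb: "r *\<^sub>R x + s *\<^sub>R y \<in> M" if "0 \<le> r" "0 \<le> s" "x \<in> M" "y \<in> M" for r s x y
  proof -
    have "(\<lambda>x y. r *\<^sub>R x + s *\<^sub>R y) \<in> (cone_ops :: ('a \<Rightarrow> 'a \<Rightarrow> 'a) set)"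
      unfolding cone_ops_def using that(1,2) by blast
    from bspec[OF bspec[OF bspec[OF closed[unfolded closed_under_def] this] that(3)] that(4)]
    show ?thesis .
  qed
  show "is_cone M"
    unfolding is_cone_def
  proof (intro conjI ballI allI impI)
    show "x + y \<in> M" if "x \<in> M" "y \<in> M" for x y
      using comb[of 1 1 x y] that by simp
    show "r *\<^sub>R x \<in> M" if "0 \<le> r" "x \<in> M" for r x
      using comb[of r 0 x x] that by simp
  qed
qed

section \<open>Separation of a point from an archimedean cone\<close>

text \<open>
  A total cone that does not contain \<open>-1\<close> cuts the real line of constants at every element \<open>x\<close>: the
  constants \<open>r\<close> with \<open>x - r\<close> in the cone form a half-line, which is nonempty and bounded above by
  the archimedean property. Its end point is the value at \<open>x\<close>. Since the end point itself need not
  be attained, equations between values are obtained by moving a distance \<open>e > 0\<close> to either side.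
\<close>

lemma functional_of_total_cone:
  fixes M :: "'a::real_algebra_1 set"
  assumes cone: "is_cone M" and one: "1 \<in> M" and arch: "archimedean M"
    and proper: "-1 \<notin> M" and total: "\<And>x. x \<in> M \<or> - x \<in> M"
  obtains L :: "'a \<Rightarrow> real" where "linear L" "L 1 = 1" "\<And>x. x \<in> M \<Longrightarrow> 0 \<le> L x"
proof -
  define S where "S x = {r. x - of_real r \<in> M}" for x :: 'a
  define L where "L x = Sup (S x)" for x
  have of_real_nonneg: "0 \<le> r" if "of_real r \<in> M" for r
  proof (rule ccontr)
    assume "\<not> 0 \<le> r"
    then have "of_real (1 / - r) * of_real r \<in> M"
      using that by (intro is_cone_scale_of_real[OF cone]) auto
    moreover have "of_real (1 / - r) * of_real r = (-1 :: 'a)"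
      using \<open>\<not> 0 \<le> r\<close> by (simp flip: of_real_mult)
    ultimately show False using proper by simp
  qed
  have upper: "s \<le> r" if "of_real r - x \<in> M" "s \<in> S x" for r s x
  proof -
    have "(of_real r - x) + (x - of_real s) \<in> M"
      using that by (intro is_cone_add[OF cone]) (auto simp: S_def)
    then show ?thesis using of_real_nonneg[of "r - s"] by simp
  qed
  have ne: "S x \<noteq> {}" for x
  proof -
    obtain r where "of_real r + x \<in> M" using arch unfolding archimedean_def by blast
    then have "- r \<in> S x" by (simp add: S_def add.commute)
    then show ?thesis by blast
  qed
  have bdd: "bdd_above (S x)" for x
  proof -
    obtain r where "of_real r + (- x) \<in> M" using arch unfolding archimedean_def by blast
    then show ?thesis using upper[of r x] by (auto simp: bdd_above_def)
  qed
  have below: "x - of_real (L x - e) \<in> M" if e: "0 < e" for x e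
  proof -
    obtain s where s: "s \<in> S x" "L x - e < s"
      using less_cSup_iff[OF ne bdd, of "L x - e" x] e unfolding L_def by auto
    have "(x - of_real s) + of_real (s - (L x - e)) \<in> M"
      using s by (intro is_cone_add[OF cone] is_cone_of_real[OF cone one]) (auto simp: S_def)
    then show ?thesis by (simp add: algebra_simps)
  qed
  have above: "of_real (L x + e) - x \<in> M" if "0 < e" for x e
  proof -
    have "L x + e \<notin> S x"
      using cSup_upper[OF _ bdd, of "L x + e" x] that unfolding L_def by auto
    then have "- (x - of_real (L x + e)) \<in> M" using total unfolding S_def by blast
    then show ?thesis by simp
  qed
  have unique: "L x = y" if lo: "\<And>e. 0 < e \<Longrightarrow> x - of_real (y - e) \<in> M"
    and hi: "\<And>e. 0 < e \<Longrightarrow> of_real (y + e) - x \<in> M" for x y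
  proof (rule antisym)
    show "L x \<le> y"
    proof (rule field_le_epsilon)
      fix e :: real assume "0 < e"
      then show "L x \<le> y + e"
        unfolding L_def by (intro cSup_least[OF ne] upper[OF hi]) auto
    qed
    show "y \<le> L x"
    proof (rule field_le_epsilon)
      fix e :: real assume "0 < e"
      then have "y - e \<le> L x"
        unfolding L_def using lo by (intro cSup_upper[OF _ bdd]) (simp add: S_def)
      then show "y \<le> L x + e" by simp
    qed
  qed
  have add: "L (x + y) = L x + L y" for x y
  proof (rule unique)
    fix e :: real assume "0 < e"
    then have e: "0 < e / 2" by simp
    have sum_halves: "of_real (e / 2) + of_real (e / 2) = (of_real e :: 'a)"
      by (simp flip: of_real_add)
    have "(x - of_real (L x - e / 2)) + (y - of_real (L y - e / 2)) \<in> M"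
      by (intro is_cone_add[OF cone] below e)
    moreover have "(x - of_real (L x - e / 2)) + (y - of_real (L y - e / 2))
        = x + y - of_real (L x + L y - e)"
      unfolding of_real_diff of_real_add sum_halves[symmetric] by (simp add: algebra_simps)
    ultimately show "x + y - of_real (L x + L y - e) \<in> M" by (simp only:)
    have "(of_real (L x + e / 2) - x) + (of_real (L y + e / 2) - y) \<in> M"
      by (intro is_cone_add[OF cone] above e)
    moreover have "(of_real (L x + e / 2) - x) + (of_real (L y + e / 2) - y)
        = of_real (L x + L y + e) - (x + y)"
      unfolding of_real_diff of_real_add sum_halves[symmetric] by (simp add: algebra_simps)
    ultimately show "of_real (L x + L y + e) - (x + y) \<in> M" by (simp only:)
  qed
  have zero: "L 0 = 0" using add[of 0 0] by simp
  have neg: "L (- x) = - L x" for x using add[of x "- x"] zero by simp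
  have scale_pos: "L (r *\<^sub>R x) = r * L x" if "0 < r" for r x
  proof (rule unique)
    fix e :: real assume "0 < e"
    then have e: "0 < e / r" using that by simp
    have "r *\<^sub>R (x - of_real (L x - e / r)) \<in> M"
      using that by (intro is_cone_scale[OF cone] below e) simp
    moreover have "r *\<^sub>R (x - of_real (L x - e / r)) = r *\<^sub>R x - of_real (r * L x - e)"
      using that by (simp add: of_real_def scaleR_diff_right right_diff_distrib)
    ultimately show "r *\<^sub>R x - of_real (r * L x - e) \<in> M" by simp
    have "r *\<^sub>R (of_real (L x + e / r) - x) \<in> M"
      using that by (intro is_cone_scale[OF cone] above e) simp
    moreover have "r *\<^sub>R (of_real (L x + e / r) - x) = of_real (r * L x + e) - r *\<^sub>R x"
      using that by (simp add: of_real_def scaleR_diff_right distrib_left)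
    ultimately show "of_real (r * L x + e) - r *\<^sub>R x \<in> M" by simp
  qed
  have scale: "L (r *\<^sub>R x) = r * L x" for r x
  proof (cases r "0 :: real" rule: linorder_cases)
    case less
    then show ?thesis using scale_pos[of "- r" x] neg[of "r *\<^sub>R x"] by simp
  qed (use zero scale_pos in auto)
  show ?thesis
  proof (rule that[of L])
    show "linear L" by (rule linearI) (simp_all add: add scale)
    show "L 1 = 1"
    proof (rule unique)
      fix e :: real assume "0 < e"
      then have "of_real e \<in> M" by (intro is_cone_of_real[OF cone one]) simp
      then show "1 - of_real (1 - e) \<in> M" "of_real (1 + e) - 1 \<in> M" by simp_all
    qed
    show "0 \<le> L x" if "x \<in> M" for x
      unfolding L_def using that by (intro cSup_upper bdd) (simp add: S_def)
  qed
qed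

text \<open>
  This is the Hahn-Banach separation of a point from a cone with order unit \<open>1\<close>. Adjoining \<open>-c\<close> to
  \<open>C\<close> does not produce \<open>-1\<close>, and a cone that is maximal with this property is total.
\<close>

lemma archimedean_cone_separation:
  fixes C :: "'a::real_algebra_1 set"
  assumes cone: "is_cone C" and one: "1 \<in> C" and arch: "archimedean C" and c: "c \<notin> C"
  obtains L :: "'a \<Rightarrow> real" where "linear L" "L 1 = 1" "\<And>x. x \<in> C \<Longrightarrow> 0 \<le> L x" "L c \<le> 0"
proof -
  define ext where "ext M a = {x + r *\<^sub>R a | x r. x \<in> M \<and> 0 \<le> r}" for M and a :: 'a
  have ext_cone: "is_cone (ext M a)" if "is_cone M" for M a
    unfolding is_cone_def
  proof (intro conjI ballI allI impI)
    fix y z assume "y \<in> ext M a" "z \<in> ext M a"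
    then obtain y' r z' s where "y' \<in> M" "z' \<in> M" "0 \<le> r" "0 \<le> s"
      "y = y' + r *\<^sub>R a" "z = z' + s *\<^sub>R a"
      unfolding ext_def by blast
    moreover from this have "y + z = (y' + z') + (r + s) *\<^sub>R a" by (simp add: algebra_simps)
    ultimately show "y + z \<in> ext M a"
      unfolding ext_def using is_cone_add[OF that] add_nonneg_nonneg by blast
  next
    fix t :: real and y assume t: "0 \<le> t" and "y \<in> ext M a"
    then obtain y' r where "y' \<in> M" "0 \<le> r" "y = y' + r *\<^sub>R a" unfolding ext_def by blast
    moreover from this have "t *\<^sub>R y = t *\<^sub>R y' + (t * r) *\<^sub>R a" by (simp add: algebra_simps)
    ultimately show "t *\<^sub>R y \<in> ext M a"
      unfolding ext_def using is_cone_scale[OF that t] mult_nonneg_nonneg[OF t] by blast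
  qed
  have ext_mono: "M \<subseteq> ext M a" for M a
    unfolding ext_def by (force intro: exI[of _ "0::real"])
  have ext_new: "a \<in> ext M a" if "0 \<in> M" for M a
    unfolding ext_def using that by (force intro: exI[of _ "1::real"])
  have zero: "0 \<in> C" using is_cone_scale[OF cone _ one, of 0] by simp
  \<comment> \<open>If \<open>-1\<close> were in the cone, then so would be every element.\<close>
  have proper: "-1 \<notin> C"
  proof
    assume m1: "-1 \<in> C"
    obtain r where r: "of_real r + c \<in> C" using arch unfolding archimedean_def by blast
    have "of_real \<bar>r\<bar> * (-1) + of_real (\<bar>r\<bar> - r) + (of_real r + c) \<in> C"
      by (intro is_cone_add[OF cone] is_cone_scale_of_real[OF cone] is_cone_of_real[OF cone one] r m1) auto
    then show False using c by simp
  qed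
  have proper_ext: "-1 \<notin> ext C (- c)"
  proof
    assume "-1 \<in> ext C (- c)"
    then obtain x r where x: "x \<in> C" "0 \<le> r" "-1 = x + r *\<^sub>R (- c)" unfolding ext_def by blast
    have "r \<noteq> 0" using x proper by auto
    have "c = (1 / r) *\<^sub>R (r *\<^sub>R c)" using \<open>r \<noteq> 0\<close> by simp
    also have "r *\<^sub>R c = x + 1" using x(3) by (simp add: algebra_simps add_eq_0_iff)
    also have "(1 / r) *\<^sub>R (x + 1) \<in> C"
      using x one by (intro is_cone_scale[OF cone] is_cone_add[OF cone]) auto
    finally show False using c by simp
  qed
  obtain M where M: "ext C (- c) \<subseteq> M" "-1 \<notin> M" and "closed_under cone_ops M"
    and maximal: "\<And>N. M \<subseteq> N \<Longrightarrow> closed_under cone_ops N \<Longrightarrow> -1 \<notin> N \<Longrightarrow> N = M"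
    using maximal_closed_set_avoiding[of cone_ops "ext C (- c)" "-1"] ext_cone[OF cone] proper_ext
    unfolding is_cone_iff_closed by blast
  then have coneM: "is_cone M" by (simp add: is_cone_iff_closed)
  have CM: "C \<subseteq> M" using M(1) ext_mono[of C "- c"] by blast
  have maxM: "\<exists>x r. x \<in> M \<and> 0 < r \<and> -1 = x + r *\<^sub>R a" if "a \<notin> M" for a
  proof -
    have "-1 \<in> ext M a"
    proof (rule ccontr)
      assume "-1 \<notin> ext M a"
      then have "ext M a = M"
        using ext_cone[OF coneM, of a] unfolding is_cone_iff_closed by (intro maximal ext_mono)
      then show False using ext_new[of M a] zero CM that by blast
    qed
    then obtain x r where x: "x \<in> M" "0 \<le> r" "-1 = x + r *\<^sub>R a" unfolding ext_def by blast
    moreover have "r \<noteq> 0" using x M(2) by auto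
    ultimately show ?thesis by (metis less_eq_real_def)
  qed
  \<comment> \<open>A positive combination cancels \<open>a\<close> in the two representations of \<open>-1\<close> that arise when neither
    \<open>a\<close> nor \<open>-a\<close> belongs to \<open>M\<close>.\<close>
  have totalM: "a \<in> M \<or> - a \<in> M" for a
  proof (rule ccontr)
    assume "\<not> ?thesis"
    then obtain x r y s where xy: "x \<in> M" "0 < r" "-1 = x + r *\<^sub>R a"
      "y \<in> M" "0 < s" "-1 = y + s *\<^sub>R (- a)"
      using maxM[of a] maxM[of "- a"] by blast
    have "(s + r) *\<^sub>R (-1 :: 'a) = s *\<^sub>R (x + r *\<^sub>R a) + r *\<^sub>R (y + s *\<^sub>R (- a))"
      unfolding xy(3,6)[symmetric] by (rule scaleR_add_left)
    also have "\<dots> = s *\<^sub>R x + r *\<^sub>R y" by (simp add: algebra_simps)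
    also have "\<dots> \<in> M" using xy by (intro is_cone_add[OF coneM] is_cone_scale[OF coneM]) auto
    finally have sum: "(s + r) *\<^sub>R (-1 :: 'a) \<in> M" .
    have "(1 / (s + r)) *\<^sub>R ((s + r) *\<^sub>R (-1 :: 'a)) \<in> M"
      using xy(2,5) is_cone_scale[OF coneM _ sum, of "1 / (s + r)"] by simp
    moreover have "(1 / (s + r)) *\<^sub>R ((s + r) *\<^sub>R (-1 :: 'a)) = -1"
      using xy(2,5) by (simp del: scaleR_minus_right)
    ultimately show False using M(2) by metis
  qed
  obtain L :: "'a \<Rightarrow> real" where L: "linear L" "L 1 = 1" "\<And>x. x \<in> M \<Longrightarrow> 0 \<le> L x"
    using functional_of_total_cone[OF coneM _ archimedean_mono[OF arch CM] M(2) totalM] one CM by blast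
  have "- c \<in> M" using M(1) ext_new[OF zero, of "- c"] by blast
  then have "0 \<le> L (- c)" by (rule L(3))
  then have "L c \<le> 0" by (simp add: linear_neg[OF L(1)])
  then show ?thesis using that[of L] L CM by blast
qed

section \<open>Positive functionals\<close>

lemma linear_of_real_mult:
  fixes L :: "'a::real_algebra_1 \<Rightarrow> real"
  shows "linear L \<Longrightarrow> L (of_real r * x) = r * L x"
  using linear_scale[of L r x] by (simp add: scaleR_conv_of_real)

lemma linear_of_real:
  fixes L :: "'a::real_algebra_1 \<Rightarrow> real"
  shows "linear L \<Longrightarrow> L (of_real r) = r * L 1"
  using linear_of_real_mult[of L r 1] by simp

lemma functional_Cauchy_Schwarz:
  fixes L :: "'a::{comm_ring_1, real_algebra_1} \<Rightarrow> real"
  assumes lin: "linear L" and pos: "\<And>x. 0 \<le> L (x\<^sup>2)"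
  shows "(L (x * y))\<^sup>2 \<le> L (x\<^sup>2) * L (y\<^sup>2)"
proof -
  have quad: "0 \<le> L (x\<^sup>2) + 2 * t * L (x * y) + t\<^sup>2 * L (y\<^sup>2)" for t
  proof -
    have "(x + of_real t * y)\<^sup>2 = x\<^sup>2 + of_real (2 * t) * (x * y) + of_real (t\<^sup>2) * y\<^sup>2"
      by (simp add: power2_eq_square algebra_simps)
    then show ?thesis
      using pos[of "x + of_real t * y"]
      by (simp only: linear_add[OF lin] linear_of_real_mult[OF lin])
  qed
  show ?thesis
  proof (cases "L (y\<^sup>2) = 0")
    case True
    have "L (x * y) = 0"
    proof (rule ccontr)
      assume "L (x * y) \<noteq> 0"
      then have "2 * (- (L (x\<^sup>2) + 1) / (2 * L (x * y))) * L (x * y) = - (L (x\<^sup>2) + 1)"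
        by (simp add: field_simps)
      then show False using quad[of "- (L (x\<^sup>2) + 1) / (2 * L (x * y))"] True by simp
    qed
    then show ?thesis using True by simp
  next
    case False
    then have D: "0 < L (y\<^sup>2)" using pos[of y] by simp
    have "0 \<le> L (x\<^sup>2) - (L (x * y))\<^sup>2 / L (y\<^sup>2)"
      using quad[of "- L (x * y) / L (y\<^sup>2)"] D
      by (simp add: power2_eq_square field_simps)
    then show ?thesis using D by (simp add: field_simps)
  qed
qed

section \<open>The Positivstellensatz for archimedean preorderings\<close>

definition is_preordering :: "'a::{comm_ring_1, real_algebra_1} set \<Rightarrow> bool" where
  "is_preordering P \<longleftrightarrow> is_cone P \<and> (\<forall>x\<in>P. \<forall>y\<in>P. x * y \<in> P) \<and> (\<forall>x. x\<^sup>2 \<in> P)"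

lemma is_preordering_one: "is_preordering P \<Longrightarrow> 1 \<in> P"
  unfolding is_preordering_def by (metis power_one)

lemma is_preordering_zero: "is_preordering P \<Longrightarrow> 0 \<in> P"
  unfolding is_preordering_def by (metis zero_power2)

text \<open>
  For a preordering \<open>P\<close> this is the preordering generated by \<open>P\<close> and \<open>a\<close>: even powers of \<open>a\<close> are
  squares and so are absorbed by \<open>P\<close>.
\<close>

definition adjoin :: "'a::{comm_ring_1, real_algebra_1} set \<Rightarrow> 'a \<Rightarrow> 'a set" where
  "adjoin P a = {x + a * y | x y. x \<in> P \<and> y \<in> P}"

lemma adjoin_mono: "is_preordering P \<Longrightarrow> P \<subseteq> adjoin P a"
  unfolding adjoin_def using is_preordering_zero by force

lemma adjoin_new: "is_preordering P \<Longrightarrow> a \<in> adjoin P a"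
  unfolding adjoin_def using is_preordering_zero[of P] is_preordering_one[of P] by force

lemma is_preordering_adjoin:
  assumes P: "is_preordering P"
  shows "is_preordering (adjoin P a)"
proof -
  have cone: "is_cone P" and mult: "\<And>x y. x \<in> P \<Longrightarrow> y \<in> P \<Longrightarrow> x * y \<in> P"
    and sq: "\<And>x. x\<^sup>2 \<in> P"
    using P by (auto simp: is_preordering_def)
  have mem: "x + a * y \<in> adjoin P a" if "x \<in> P" "y \<in> P" for x y
    unfolding adjoin_def using that by blast
  have "y + z \<in> adjoin P a \<and> y * z \<in> adjoin P a" if y: "y \<in> adjoin P a" and z: "z \<in> adjoin P a" for y z
  proof -
    obtain p q where "p \<in> P" "q \<in> P" "y = p + a * q" using y unfolding adjoin_def by blast
    moreover obtain p' q' where "p' \<in> P" "q' \<in> P" "z = p' + a * q'"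
      using z unfolding adjoin_def by blast
    ultimately have pq: "p \<in> P" "q \<in> P" "p' \<in> P" "q' \<in> P" "y = p + a * q" "z = p' + a * q'"
      by simp_all
    have "y + z = (p + p') + a * (q + q')" "y * z = (p * p' + a\<^sup>2 * (q * q')) + a * (p * q' + p' * q)"
      unfolding pq(5,6) by (simp_all add: algebra_simps power2_eq_square)
    moreover have "(p + p') + a * (q + q') \<in> adjoin P a"
      "(p * p' + a\<^sup>2 * (q * q')) + a * (p * q' + p' * q) \<in> adjoin P a"
      by (intro mem is_cone_add[OF cone] mult sq pq)+
    ultimately show ?thesis by simp
  qed
  moreover have "r *\<^sub>R y \<in> adjoin P a" if r: "0 \<le> r" and y: "y \<in> adjoin P a" for r y
  proof -
    obtain p q where pq: "p \<in> P" "q \<in> P" "y = p + a * q" using y unfolding adjoin_def by blast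
    have "r *\<^sub>R y = r *\<^sub>R p + a * (r *\<^sub>R q)" unfolding pq(3) by (simp add: algebra_simps)
    moreover have "r *\<^sub>R p + a * (r *\<^sub>R q) \<in> adjoin P a"
      by (intro mem is_cone_scale[OF cone] r pq)
    ultimately show ?thesis by (simp only:)
  qed
  moreover have "x\<^sup>2 \<in> adjoin P a" for x using adjoin_mono[OF P] sq by blast
  ultimately show ?thesis unfolding is_preordering_def is_cone_def by blast
qed

text \<open>
  A preordering that is maximal among those without \<open>-1\<close> is total, so it defines a functional \<open>L\<close>.
  Closure under products makes \<open>L\<close> multiplicative: the variance of every element \<open>x\<close>, that is the
  value at \<open>(x - L x)\<^sup>2\<close>, vanishes, so by Cauchy-Schwarz \<open>x - L x\<close> is annihilated together with all its
  multiples.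
\<close>

lemma character_of_archimedean_preordering:
  fixes P :: "'a::{comm_ring_1, real_algebra_1} set"
  assumes P: "is_preordering P" and arch: "archimedean P" and proper: "-1 \<notin> P"
  obtains \<alpha> where "\<alpha> \<in> characters" "\<And>x. x \<in> P \<Longrightarrow> 0 \<le> \<alpha> x"
proof -
  define Ops where "Ops = insert (*) (cone_ops :: ('a \<Rightarrow> 'a \<Rightarrow> 'a) set)"
  have Ops: "is_preordering M \<longleftrightarrow> closed_under Ops M" if "P \<subseteq> M" for M
  proof -
    have "\<forall>x. x\<^sup>2 \<in> M" using P that unfolding is_preordering_def by blast
    then show ?thesis
      unfolding is_preordering_def is_cone_iff_closed closed_under_def Ops_def by auto
  qed
  obtain M where M: "P \<subseteq> M" "-1 \<notin> M" and "closed_under Ops M"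
    and maximal: "\<And>N. M \<subseteq> N \<Longrightarrow> closed_under Ops N \<Longrightarrow> -1 \<notin> N \<Longrightarrow> N = M"
    using maximal_closed_set_avoiding[of Ops P "-1"] P Ops[OF order_refl] proper by blast
  then have preM: "is_preordering M" by (simp add: Ops)
  have cone: "is_cone M" and mult: "\<And>x y. x \<in> M \<Longrightarrow> y \<in> M \<Longrightarrow> x * y \<in> M"
    and sq: "\<And>x. x\<^sup>2 \<in> M"
    using preM by (auto simp: is_preordering_def)
  have maxM: "\<exists>p q. p \<in> M \<and> q \<in> M \<and> -1 = p + a * q" if "a \<notin> M" for a
  proof -
    have "-1 \<in> adjoin M a"
    proof (rule ccontr)
      assume neg: "-1 \<notin> adjoin M a"
      have sub: "P \<subseteq> adjoin M a" using M(1) adjoin_mono[OF preM] by blast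
      have "adjoin M a = M"
        using is_preordering_adjoin[OF preM, of a] unfolding Ops[OF sub]
        by (intro maximal adjoin_mono[OF preM] neg)
      then show False using adjoin_new[OF preM, of a] that by blast
    qed
    then show ?thesis unfolding adjoin_def by blast
  qed
  have totalM: "a \<in> M \<or> - a \<in> M" for a
  proof (rule ccontr)
    assume "\<not> ?thesis"
    then obtain p q p' q' where pq: "p \<in> M" "q \<in> M" "-1 = p + a * q"
      "p' \<in> M" "q' \<in> M" "-1 = p' + (- a) * q'"
      using maxM[of a] maxM[of "- a"] by blast
    \<comment> \<open>Multiplying \<open>1 + p = - a q\<close> and \<open>1 + p' = a q'\<close> turns \<open>a\<close> into a square.\<close>
    have "p + p' + p * p' + a\<^sup>2 * (q * q') = - 1"
    proof -
      have "1 + p = - (a * q)" "1 + p' = a * q'"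
        using arg_cong[OF pq(3), of "\<lambda>z. 1 + z - a * q"] arg_cong[OF pq(6), of "\<lambda>z. 1 + z + a * q'"]
        by (simp_all add: algebra_simps)
      then have "(1 + p) * (1 + p') + a\<^sup>2 * (q * q') = 0"
        by (simp add: power2_eq_square mult_ac)
      then show ?thesis unfolding eq_neg_iff_add_eq_0 by (simp add: algebra_simps)
    qed
    moreover have "p + p' + p * p' + a\<^sup>2 * (q * q') \<in> M"
      using pq by (intro is_cone_add[OF cone] mult sq)
    ultimately show False using M(2) by simp
  qed
  obtain L :: "'a \<Rightarrow> real" where L: "linear L" "L 1 = 1" "\<And>x. x \<in> M \<Longrightarrow> 0 \<le> L x"
    using functional_of_total_cone[OF cone is_preordering_one[OF preM]
        archimedean_mono[OF arch M(1)] M(2) totalM] by blast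
  have pos_mem: "x \<in> M" if "0 < L x" for x
    using totalM[of x] L(3)[of "- x"] that by (auto simp: linear_neg[OF L(1)])
  have L_of_real: "L (of_real r) = r" for r using linear_of_real[OF L(1), of r] L(2) by simp
  have "L (x * y) = L x * L y" for x y
  proof -
    define z where "z = x - of_real (L x)"
    have Lz: "L z = 0" by (simp add: z_def linear_diff[OF L(1)] L_of_real)
    \<comment> \<open>Both \<open>e + z\<close> and \<open>e - z\<close> lie in \<open>M\<close>, hence so does their product \<open>e\<^sup>2 - z\<^sup>2\<close>.\<close>
    have "L (z\<^sup>2) \<le> 0 + e" if "0 < e" for e
    proof -
      define d where "d = sqrt e"
      have d: "0 < d" "d\<^sup>2 = e" using that by (auto simp: d_def)
      have "of_real d + z \<in> M" "of_real d - z \<in> M"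
        using d by (auto intro!: pos_mem simp: linear_add[OF L(1)] linear_diff[OF L(1)] L_of_real Lz)
      then have "(of_real d + z) * (of_real d - z) \<in> M" by (rule mult)
      also have "(of_real d + z) * (of_real d - z) = of_real e - z\<^sup>2"
        unfolding d(2)[symmetric] by (simp add: algebra_simps power2_eq_square)
      finally show ?thesis using L(3) by (auto simp: linear_diff[OF L(1)] L_of_real dest: L(3))
    qed
    then have "L (z\<^sup>2) \<le> 0" by (rule field_le_epsilon)
    moreover have sqpos: "0 \<le> L (w\<^sup>2)" for w using L(3) sq by blast
    ultimately have "L (z\<^sup>2) = 0" by (simp add: order_antisym)
    then have "L (z * y) = 0"
      using functional_Cauchy_Schwarz[OF L(1) sqpos, of z y] by simp
    then show ?thesis
      by (simp add: z_def left_diff_distrib linear_diff[OF L(1)] linear_of_real_mult[OF L(1)])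
  qed
  then have "L \<in> characters" using L by (simp add: characters_def)
  then show ?thesis using that[of L] L(3) M(1) by blast
qed

text \<open>
  If no character is nonnegative on \<open>P\<close> and on \<open>-c\<close>, then adjoining \<open>-c\<close> to \<open>P\<close> produces \<open>-1\<close>, that is
  \<open>c * q = 1 + p\<close> with \<open>p\<close> and \<open>q\<close> in \<open>P\<close>. Woermann's argument removes the denominator \<open>q\<close>: if \<open>q \<le> k\<close>,
  then a lower bound \<open>c \<ge> -r\<close> with \<open>r \<ge> 0\<close> can be improved by \<open>1 / k\<close>. Starting from a bound that
  is a multiple of \<open>1 / k\<close>, finitely many steps lead to \<open>c \<ge> 0\<close>, and one more to \<open>c \<ge> 1 / k\<close>.
\<close>

lemma archimedean_Positivstellensatz:
  fixes P :: "'a::{comm_ring_1, real_algebra_1} set"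
  assumes P: "is_preordering P" and arch: "archimedean P"
    and pos: "\<And>\<alpha>. \<alpha> \<in> characters \<Longrightarrow> (\<And>x. x \<in> P \<Longrightarrow> 0 \<le> \<alpha> x) \<Longrightarrow> 0 < \<alpha> c"
  obtains d :: real where "0 < d" "c - of_real d \<in> P"
proof -
  have cone: "is_cone P" and mult: "\<And>x y. x \<in> P \<Longrightarrow> y \<in> P \<Longrightarrow> x * y \<in> P"
    using P by (auto simp: is_preordering_def)
  note one = is_preordering_one[OF P]
  have "-1 \<in> adjoin P (- c)"
  proof (rule ccontr)
    assume "-1 \<notin> adjoin P (- c)"
    then obtain \<alpha> where \<alpha>: "\<alpha> \<in> characters" "\<And>x. x \<in> adjoin P (- c) \<Longrightarrow> 0 \<le> \<alpha> x"
      using character_of_archimedean_preordering[OF is_preordering_adjoin[OF P]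
          archimedean_mono[OF arch adjoin_mono[OF P]]] by blast
    have "0 \<le> \<alpha> (- c)" using \<alpha>(2) adjoin_new[OF P] by blast
    then have "\<alpha> c \<le> 0" using \<alpha>(1) by (simp add: characters_def linear_neg)
    moreover have "0 < \<alpha> c" using pos[OF \<alpha>(1)] \<alpha>(2) adjoin_mono[OF P] by blast
    ultimately show False by simp
  qed
  then obtain p q where pq: "p \<in> P" "q \<in> P" "-1 = p + (- c) * q" unfolding adjoin_def by blast
  have cq: "c * q - 1 \<in> P"
  proof -
    have "c * q - 1 = p" using pq(3) by (simp add: algebra_simps)
    then show ?thesis using pq(1) by simp
  qed
  obtain k where k: "0 < k" "of_real k - q \<in> P"
  proof -
    obtain r where r: "of_real r + (- q) \<in> P" using arch unfolding archimedean_def by blast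
    have "of_real (max r 1 - r) + (of_real r + (- q)) \<in> P"
      by (intro is_cone_add[OF cone] is_cone_of_real[OF cone one] r) auto
    then show ?thesis using that[of "max r 1"] by (simp add: algebra_simps)
  qed
  have descend: "c + of_real (r - 1 / k) \<in> P" if r: "0 \<le> r" "c + of_real r \<in> P" for r
  proof -
    have "of_real (1 / k) * ((of_real k - q) * (c + of_real r) + (c * q - 1) + of_real r * q) \<in> P"
      using k(1) by (intro is_cone_scale_of_real[OF cone] is_cone_add[OF cone] mult r k cq pq) simp
    moreover have "(of_real k - q) * (c + of_real r) + (c * q - 1) + of_real r * q
        = of_real k * (c + of_real r) - 1"
      by (simp add: algebra_simps)
    moreover have "of_real (1 / k) * (of_real k * (c + of_real r) - 1) = c + of_real (r - 1 / k)"
      using k(1) by (simp add: right_diff_distrib flip: mult.assoc of_real_mult)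
    ultimately show ?thesis by simp
  qed
  have "c + of_real (real m / k) \<in> P \<Longrightarrow> c - of_real (1 / k) \<in> P" for m
  proof (induction m)
    case 0
    then show ?case using descend[of 0] by simp
  next
    case (Suc m)
    have "real (Suc m) / k - 1 / k = real m / k" using k(1) by (simp add: field_simps)
    then have "c + of_real (real m / k) \<in> P"
      using descend[of "real (Suc m) / k"] Suc.prems k(1) by simp
    then show ?case by (rule Suc.IH)
  qed
  moreover obtain m :: nat where "c + of_real (real m / k) \<in> P"
  proof -
    obtain r where r: "of_real r + c \<in> P" using arch unfolding archimedean_def by blast
    obtain m :: nat where "r * k \<le> real m" using real_arch_simple by blast
    then have "r \<le> real m / k" using k(1) by (simp add: field_simps)
    then have "(of_real r + c) + of_real (real m / k - r) \<in> P"
      by (intro is_cone_add[OF cone] is_cone_of_real[OF cone one] r) auto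
    then show ?thesis using that[of m] by (simp add: algebra_simps)
  qed
  ultimately show ?thesis using that[of "1 / k"] k(1) by simp
qed

section \<open>Positive functionals of bounded growth\<close>

text \<open>
  The constant \<open>D\<close> may depend on \<open>a\<close> and on the functional. This slack is what makes the class stable
  under multiplication by elements (\<open>growth_functional_mult\<close>), and it disappears in the limit of
  large \<open>n\<close> (\<open>growth_functional_bound\<close>).
\<close>

definition growth_functionals :: "('a::{comm_ring_1, real_algebra_1} \<Rightarrow> real) \<Rightarrow> ('a \<Rightarrow> real) set" where
  "growth_functionals T = {L. linear L \<and> (\<forall>x. 0 \<le> L (x\<^sup>2)) \<and>
     (\<forall>a. \<exists>D. \<forall>n. L (a ^ (2 * n)) \<le> D * T a ^ (2 * n))}"

text \<open>
  Only the growth bound needs an argument: by Cauchy-Schwarz \<open>L (p * a ^ (2 * n))\<close> is at most the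
  geometric mean of \<open>L (p\<^sup>2)\<close> and \<open>L (a ^ (4 * n))\<close>.
\<close>

lemma growth_functional_mult:
  assumes L: "L \<in> growth_functionals T" and T: "\<And>a. 0 < T a" and p: "\<And>x. 0 \<le> L (p * x\<^sup>2)"
  shows "(\<lambda>x. L (p * x)) \<in> growth_functionals T"
proof -
  have lin: "linear L" and pos: "\<And>x. 0 \<le> L (x\<^sup>2)" using L by (auto simp: growth_functionals_def)
  have "\<exists>E. \<forall>n. L (p * a ^ (2 * n)) \<le> E * T a ^ (2 * n)" for a
  proof -
    obtain D where D: "\<And>n. L (a ^ (2 * n)) \<le> D * T a ^ (2 * n)"
      using L unfolding growth_functionals_def by blast
    have D0: "0 \<le> D" using D[of 0] pos[of 1] by simp
    have "L (p * a ^ (2 * n)) \<le> sqrt (L (p\<^sup>2) * D) * T a ^ (2 * n)" for n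
    proof (rule power2_le_imp_le)
      have "(L (p * a ^ (2 * n)))\<^sup>2 \<le> L (p\<^sup>2) * L ((a ^ (2 * n))\<^sup>2)"
        by (rule functional_Cauchy_Schwarz[OF lin pos])
      also have "(a ^ (2 * n))\<^sup>2 = a ^ (2 * (2 * n))" by (simp add: mult.commute flip: power_mult)
      also have "L (p\<^sup>2) * L (a ^ (2 * (2 * n))) \<le> L (p\<^sup>2) * (D * T a ^ (2 * (2 * n)))"
        by (intro mult_left_mono D pos)
      also have "\<dots> = (sqrt (L (p\<^sup>2) * D) * T a ^ (2 * n))\<^sup>2"
      proof -
        have "T a ^ (2 * (2 * n)) = (T a ^ (2 * n))\<^sup>2" by (simp add: mult.commute flip: power_mult)
        then show ?thesis using D0 pos[of p] by (simp add: power_mult_distrib)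
      qed
      finally show "(L (p * a ^ (2 * n)))\<^sup>2 \<le> (sqrt (L (p\<^sup>2) * D) * T a ^ (2 * n))\<^sup>2" .
    qed (use D0 pos[of p] T[of a] in simp)
    then show ?thesis by blast
  qed
  moreover have "linear (\<lambda>x. L (p * x))"
    by (rule linearI) (simp_all add: distrib_left linear_add[OF lin] linear_scale[OF lin])
  ultimately show ?thesis using p by (auto simp: growth_functionals_def)
qed

text \<open>
  Cauchy-Schwarz makes the moments log-convex: if the ratio of \<open>L (b\<^sup>2)\<close> to \<open>L 1\<close> exceeded \<open>(T b)\<^sup>2\<close> by a
  factor \<open>s > 1\<close>, then repeated squaring would make \<open>L (b ^ (2 * 2 ^ n))\<close> exceed
  \<open>T b ^ (2 * 2 ^ n)\<close> by a factor of order \<open>s ^ 2 ^ n\<close>, which no constant \<open>D\<close> can bound.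
\<close>

lemma growth_functional_bound:
  assumes L: "L \<in> growth_functionals T" and T: "0 < T b"
  shows "\<bar>L b\<bar> \<le> T b * L 1"
proof -
  have lin: "linear L" and pos: "\<And>x. 0 \<le> L (x\<^sup>2)" using L by (auto simp: growth_functionals_def)
  have L1: "0 \<le> L 1" using pos[of 1] by simp
  have CS1: "(L x)\<^sup>2 \<le> L 1 * L (x\<^sup>2)" for x
    using functional_Cauchy_Schwarz[OF lin pos, of 1 x] by simp
  have sq: "L (b\<^sup>2) \<le> (T b)\<^sup>2 * L 1"
  proof (cases "L 1 = 0")
    case True
    then show ?thesis using CS1[of "b\<^sup>2"] by simp
  next
    case False
    then have L1: "0 < L 1" using L1 by simp
    show ?thesis
    proof (rule ccontr)
      define s where "s = L (b\<^sup>2) / ((T b)\<^sup>2 * L 1)"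
      assume "\<not> ?thesis"
      then have s: "1 < s" using L1 T by (simp add: s_def field_simps)
      obtain D where D: "\<And>n. L (b ^ (2 * n)) \<le> D * T b ^ (2 * n)"
        using L unfolding growth_functionals_def by blast
      have lower: "L 1 * (s * (T b)\<^sup>2) ^ 2 ^ n \<le> L (b ^ (2 * 2 ^ n))" for n
      proof (induction n)
        case 0
        then show ?case using L1 T by (simp add: s_def power2_eq_square)
      next
        case (Suc n)
        have "L 1 * (L 1 * (s * (T b)\<^sup>2) ^ 2 ^ Suc n) = (L 1 * (s * (T b)\<^sup>2) ^ 2 ^ n)\<^sup>2"
          by (simp add: power_mult_distrib power2_eq_square mult_2 power_add algebra_simps)
        also have "\<dots> \<le> (L (b ^ (2 * 2 ^ n)))\<^sup>2"
          using Suc L1 s by (intro power_mono) auto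
        also have "\<dots> \<le> L 1 * L ((b ^ (2 * 2 ^ n))\<^sup>2)" by (rule CS1)
        also have "(b ^ (2 * 2 ^ n))\<^sup>2 = b ^ (2 * 2 ^ Suc n)"
          by (simp add: mult.commute flip: power_mult)
        finally show ?case using L1 by simp
      qed
      have upper: "s ^ 2 ^ n \<le> D / L 1" for n
      proof -
        have "L 1 * s ^ 2 ^ n * ((T b)\<^sup>2) ^ 2 ^ n \<le> D * ((T b)\<^sup>2) ^ 2 ^ n"
          using order_trans[OF lower[of n] D[of "2 ^ n"]]
          by (simp add: power_mult_distrib power_mult mult.assoc)
        then have "L 1 * s ^ 2 ^ n \<le> D" using T by simp
        then show ?thesis using L1 by (simp add: field_simps)
      qed
      obtain n where "D / L 1 < s ^ n" using real_arch_pow[OF s] by blast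
      also have "s ^ n \<le> s ^ 2 ^ n" using s by (intro power_increasing) (auto simp: less_imp_le)
      finally show False using upper[of n] by simp
    qed
  qed
  have "(L b)\<^sup>2 \<le> L 1 * L (b\<^sup>2)" by (rule CS1)
  also have "\<dots> \<le> L 1 * ((T b)\<^sup>2 * L 1)" by (intro mult_left_mono sq L1)
  also have "\<dots> = (T b * L 1)\<^sup>2" by (simp add: power2_eq_square)
  finally show ?thesis using L1 T by (simp add: abs_le_square_iff[symmetric])
qed

text \<open>
  Closure under products uses \<open>growth_functional_mult\<close> twice: multiplication by a square \<open>x\<^sup>2\<close> shows that
  \<open>L (p * x\<^sup>2) \<ge> 0\<close> for \<open>p\<close> in the set, and this allows multiplication by \<open>p\<close>.
\<close>

lemma is_preordering_growth_positive:
  fixes T :: "'a::{comm_ring_1, real_algebra_1} \<Rightarrow> real"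
  assumes T: "\<And>a. 0 < T a"
  shows "is_preordering {p. \<forall>L \<in> growth_functionals T. 0 \<le> L p}" (is "is_preordering ?P")
proof -
  have lin: "linear L" and pos: "\<And>x. 0 \<le> L (x\<^sup>2)" if "L \<in> growth_functionals T" for L
    using that by (auto simp: growth_functionals_def)
  have "p * q \<in> ?P" if pq: "p \<in> ?P" "q \<in> ?P" for p q
  proof safe
    fix L assume L: "L \<in> growth_functionals T"
    have "0 \<le> L (p * x\<^sup>2)" for x
    proof -
      have "0 \<le> L (x\<^sup>2 * y\<^sup>2)" for y using pos[OF L, of "x * y"] by (simp add: power_mult_distrib)
      then have "(\<lambda>y. L (x\<^sup>2 * y)) \<in> growth_functionals T" by (rule growth_functional_mult[OF L T])
      then show ?thesis using pq(1) by (auto simp: mult.commute)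
    qed
    then have "(\<lambda>x. L (p * x)) \<in> growth_functionals T" by (rule growth_functional_mult[OF L T])
    then show "0 \<le> L (p * q)" using pq(2) by auto
  qed
  then show ?thesis
    unfolding is_preordering_def is_cone_def
    by (auto simp: linear_add[OF lin] linear_scale[OF lin] pos)
qed

section \<open>Functionals nonnegative on the generators\<close>

text \<open>
  Think of \<open>u\<close> and \<open>v\<close> as the probabilities of a step \<open>-1\<close> and \<open>1\<close> of a random walk, so that \<open>v - u\<close> is
  the mean of a step and \<open>4 * u * v\<close> its variance. Then
  \<open>(s + n * (v - u))\<^sup>2 + 4 * n * u * v\<close> is the expected squared position after \<open>n\<close> steps from \<open>s\<close>, and
  conditioning on the first step expresses it by the same formula for \<open>n - 1\<close> steps from \<open>s + 1\<close>
  and from \<open>s - 1\<close>. Unfolded, this is the Bernstein expansion of degree \<open>n\<close>, whose coefficients are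
  squares times binomial coefficients. Likewise \<open>(v - u) ^ n\<close> is the expected product of \<open>n\<close> steps,
  which explains the recursion for \<open>1 + (v - u) ^ n\<close> and \<open>1 - (v - u) ^ n\<close>.
\<close>

lemma interval_cone:
  fixes u v :: "'a::{comm_ring_1, real_algebra_1}"
  assumes cone: "is_cone Q" and one: "1 \<in> Q" and uv: "u + v = 1"
    and u: "\<And>z. z \<in> Q \<Longrightarrow> u * z \<in> Q" and v: "\<And>z. z \<in> Q \<Longrightarrow> v * z \<in> Q"
  shows interval_cone_power: "1 + (v - u) ^ n \<in> Q \<and> 1 - (v - u) ^ n \<in> Q"
    and interval_cone_square: "(of_real s + of_nat n * (v - u))\<^sup>2 + 4 * of_nat n * (u * v) \<in> Q"
proof -
  have u_eq: "u = 1 - v" using uv by (simp add: eq_diff_eq)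
  show "1 + (v - u) ^ n \<in> Q \<and> 1 - (v - u) ^ n \<in> Q"
  proof (induction n)
    case 0
    then show ?case using is_cone_of_real[OF cone one, of 2] is_cone_of_real[OF cone one, of 0] by simp
  next
    case (Suc n)
    have "1 + (v - u) ^ Suc n = v * (1 + (v - u) ^ n) + u * (1 - (v - u) ^ n)"
      "1 - (v - u) ^ Suc n = v * (1 - (v - u) ^ n) + u * (1 + (v - u) ^ n)"
      unfolding power_Suc u_eq by (simp_all add: algebra_simps)
    then show ?case using Suc by (auto intro!: is_cone_add[OF cone] u v)
  qed
  show "(of_real s + of_nat n * (v - u))\<^sup>2 + 4 * of_nat n * (u * v) \<in> Q"
  proof (induction n arbitrary: s)
    case 0
    then show ?case using is_cone_of_real[OF cone one, of "s\<^sup>2"] by simp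
  next
    case (Suc n)
    let ?f = "\<lambda>s. (of_real s + of_nat n * (v - u))\<^sup>2 + 4 * of_nat n * (u * v)"
    have "(of_real s + of_nat (Suc n) * (v - u))\<^sup>2 + 4 * of_nat (Suc n) * (u * v)
      = v * ?f (s + 1) + u * ?f (s - 1)"
      unfolding u_eq by (simp add: algebra_simps power2_eq_square)
    also have "\<dots> \<in> Q" by (intro is_cone_add[OF cone] u v Suc)
    finally show ?case .
  qed
qed

text \<open>
  With \<open>u = (T a - a) / (2 * T a)\<close> and \<open>v = (T a + a) / (2 * T a)\<close> one has \<open>u + v = 1\<close> and
  \<open>a = T a * (v - u)\<close>. In the second part of \<open>interval_cone\<close> with \<open>s = 0\<close> the term \<open>4 * n * (u * v)\<close> is
  negligible against \<open>n\<^sup>2 * (v - u)\<^sup>2\<close> for large \<open>n\<close>, which gives \<open>L (a\<^sup>2) \<ge> 0\<close>.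
\<close>

lemma growth_functional_of_generators:
  fixes T :: "'a::{comm_ring_1, real_algebra_1} \<Rightarrow> real"
  assumes lin: "linear L" and one: "L 1 = 1" and T: "\<And>a. 0 < T a"
    and gen: "\<And>a j k. 0 \<le> L ((of_real (T a) - a) ^ j * (of_real (T a) + a) ^ k)"
  shows "L \<in> growth_functionals T"
proof -
  have "0 \<le> L (a\<^sup>2) \<and> (\<forall>n. L (a ^ (2 * n)) \<le> 1 * T a ^ (2 * n))" for a
  proof -
    define t where "t = T a"
    have t: "0 < t" using T by (simp add: t_def)
    define h where "h = (of_real (1 / (2 * t)) :: 'a)"
    define u where "u = h * (of_real t - a)"
    define v where "v = h * (of_real t + a)"
    have h: "h * of_real t + h * of_real t = 1"
      using t unfolding h_def by (simp flip: of_real_mult of_real_add)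
    have uv: "u + v = 1" using h by (simp add: u_def v_def algebra_simps)
    have w: "a = of_real t * (v - u)"
    proof -
      have "of_real t * (v - u) = (h * of_real t + h * of_real t) * a"
        by (simp add: u_def v_def algebra_simps)
      then show ?thesis using h by simp
    qed
    \<comment> \<open>The largest cone on which \<open>L\<close> is nonnegative and that is stable under multiplication
      by \<open>u\<close> and \<open>v\<close>.\<close>
    define Q where "Q = {z. \<forall>j k. 0 \<le> L (u ^ j * v ^ k * z)}"
    have Qpos: "0 \<le> L z" if "z \<in> Q" for z
    proof -
      have "0 \<le> L (u ^ 0 * v ^ 0 * z)" using that unfolding Q_def by blast
      then show ?thesis by simp
    qed
    have coneQ: "is_cone Q"
      by (auto simp: is_cone_def Q_def distrib_left linear_add[OF lin] linear_scale[OF lin])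
    have oneQ: "1 \<in> Q"
    proof -
      have "u ^ j * v ^ k = of_real ((1 / (2 * t)) ^ (j + k)) * ((of_real t - a) ^ j * (of_real t + a) ^ k)" for j k
        unfolding u_def v_def h_def power_mult_distrib power_add of_real_mult of_real_power
        by (simp only: mult_ac)
      then have "0 \<le> L (u ^ j * v ^ k)" for j k
        using gen[of a j k] t by (simp only: linear_of_real_mult[OF lin]) (simp add: t_def)
      then show ?thesis by (simp add: Q_def)
    qed
    have uQ: "u * z \<in> Q" if "z \<in> Q" for z
    proof -
      have "0 \<le> L (u ^ Suc j * v ^ k * z)" for j k using that unfolding Q_def by blast
      then show ?thesis by (simp add: Q_def mult_ac)
    qed
    have vQ: "v * z \<in> Q" if "z \<in> Q" for z
    proof -
      have "0 \<le> L (u ^ j * v ^ Suc k * z)" for j k using that unfolding Q_def by blast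
      then show ?thesis by (simp add: Q_def mult_ac)
    qed
    have power: "L (a ^ (2 * n)) \<le> 1 * T a ^ (2 * n)" for n
    proof -
      have "0 \<le> L (1 - (v - u) ^ (2 * n))"
        using interval_cone_power[OF coneQ oneQ uv uQ vQ] Qpos by blast
      then have "L ((v - u) ^ (2 * n)) \<le> 1" by (simp add: linear_diff[OF lin] one)
      moreover have "a ^ (2 * n) = of_real (t ^ (2 * n)) * (v - u) ^ (2 * n)"
        by (subst w) (simp add: power_mult_distrib)
      ultimately show ?thesis
        using t by (simp only: linear_of_real_mult[OF lin] t_def[symmetric]) simp
    qed
    have "- L ((v - u)\<^sup>2) \<le> 0 + e" if "0 < e" for e
    proof -
      obtain n :: nat where n: "4 * L (u * v) / e + 1 \<le> real n" using real_arch_simple by blast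
      have Luv: "0 \<le> L (u * v)" using Qpos[OF uQ[OF vQ[OF oneQ]]] by simp
      have n1: "1 \<le> real n" using n Luv that by (smt (verit) divide_nonneg_pos)
      have "(of_real 0 + of_nat n * (v - u))\<^sup>2 + 4 * of_nat n * (u * v) \<in> Q"
        by (rule interval_cone_square[OF coneQ oneQ uv uQ vQ])
      moreover have "(of_real 0 + of_nat n * (v - u))\<^sup>2 + 4 * of_nat n * (u * v)
          = of_real ((real n)\<^sup>2) * (v - u)\<^sup>2 + of_real (4 * real n) * (u * v)"
        by (simp add: power_mult_distrib)
      ultimately have "0 \<le> (real n)\<^sup>2 * L ((v - u)\<^sup>2) + 4 * real n * L (u * v)"
        using Qpos by (metis linear_add[OF lin] linear_of_real_mult[OF lin])
      then have "0 \<le> real n * (real n * L ((v - u)\<^sup>2) + 4 * L (u * v))"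
        by (simp add: algebra_simps power2_eq_square)
      then have "0 \<le> real n * L ((v - u)\<^sup>2) + 4 * L (u * v)"
        using n1 by (simp add: zero_le_mult_iff)
      moreover have "4 * L (u * v) \<le> real n * e" using n that by (simp add: field_simps)
      ultimately have "real n * (- L ((v - u)\<^sup>2)) \<le> real n * e" by simp
      then show ?thesis using n1 mult_le_cancel_left_pos[of "real n" "- L ((v - u)\<^sup>2)" e] by linarith
    qed
    then have "- L ((v - u)\<^sup>2) \<le> 0" by (rule field_le_epsilon)
    moreover have "a\<^sup>2 = of_real (t\<^sup>2) * (v - u)\<^sup>2" by (subst w) (simp add: power_mult_distrib)
    ultimately have "0 \<le> L (a\<^sup>2)" by (simp only: linear_of_real_mult[OF lin]) simp
    then show ?thesis using power by blast
  qed
  then show ?thesis using lin unfolding growth_functionals_def by blast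
qed

theorem proposition2p8:
  fixes T :: "'a::{comm_ring_1, real_algebra_1} \<Rightarrow> real"
    and K :: "('a \<Rightarrow> real) set"
    and C :: "'a set"
    and c :: 'a
  assumes "(characters :: ('a \<Rightarrow> real) set) \<noteq> {}"
    and "\<And>a. T a > 0"
    and "C = unital_cone_generated (generators T)"
    and "K = {\<alpha> \<in> characters. \<forall>a. \<bar>\<alpha> a\<bar> \<le> T a}"
    and "\<And>\<alpha>. \<alpha> \<in> K \<Longrightarrow> \<alpha> c > 0"
  shows "c \<in> C"
proof (rule ccontr)
  assume c: "c \<notin> C"
  note T = assms(2)
  define P where "P = {p. \<forall>L \<in> growth_functionals T. 0 \<le> L p}"
  have cone: "is_cone C" unfolding assms(3) by (rule is_cone_unital_cone_generated)
  have sub: "generators T \<union> {1} \<subseteq> C"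
    unfolding assms(3) unital_cone_generated_def by (rule hull_subset)
  have gen: "(of_real (T a) - a) ^ j * (of_real (T a) + a) ^ k \<in> C" for a j k
  proof -
    have "(of_real (T a) - a) ^ j * (of_real (T a) + a) ^ k \<in> generators T"
      unfolding generators_def by (intro UnI1 CollectI exI[of _ a] exI[of _ j] exI[of _ k]) simp
    then show ?thesis using sub by blast
  qed
  have arch: "archimedean C"
    unfolding archimedean_def
  proof
    fix x
    have "of_real (T x) + x \<in> C" using gen[of x 0 1] by simp
    then show "\<exists>r. of_real r + x \<in> C" ..
  qed
  have oneC: "1 \<in> C" using sub by blast
  obtain L :: "'a \<Rightarrow> real" where L: "linear L" "L 1 = 1" "\<And>x. x \<in> C \<Longrightarrow> 0 \<le> L x" "L c \<le> 0"
    using archimedean_cone_separation[OF cone oneC arch c] by blast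
  have L_growth: "L \<in> growth_functionals T"
    by (rule growth_functional_of_generators[OF L(1,2) T L(3)[OF gen]])
  have preP: "is_preordering P" unfolding P_def using T by (rule is_preordering_growth_positive)
  have T_bounds: "of_real (T b) + b \<in> P" "of_real (T b) - b \<in> P" for b
  proof -
    have "0 \<le> F (of_real (T b) + b)" "0 \<le> F (of_real (T b) - b)" if F: "F \<in> growth_functionals T" for F
    proof -
      have "linear F" using F by (simp add: growth_functionals_def)
      then show "0 \<le> F (of_real (T b) + b)" "0 \<le> F (of_real (T b) - b)"
        using growth_functional_bound[OF F T, of b]
        by (simp_all add: linear_add linear_diff linear_of_real)
    qed
    then show "of_real (T b) + b \<in> P" "of_real (T b) - b \<in> P" by (auto simp: P_def)
  qed
  have archP: "archimedean P" unfolding archimedean_def using T_bounds by blast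
  have "0 < \<alpha> c" if \<alpha>: "\<alpha> \<in> characters" "\<And>x. x \<in> P \<Longrightarrow> 0 \<le> \<alpha> x" for \<alpha>
  proof -
    have lin: "linear \<alpha>" "\<alpha> 1 = 1" using \<alpha>(1) by (auto simp: characters_def)
    have "\<bar>\<alpha> b\<bar> \<le> T b" for b
      using \<alpha>(2)[OF T_bounds(1), of b] \<alpha>(2)[OF T_bounds(2), of b]
      by (simp add: linear_add[OF lin(1)] linear_diff[OF lin(1)] linear_of_real[OF lin(1)] lin(2) abs_le_iff)
    then show ?thesis using \<alpha>(1) assms(4,5) by blast
  qed
  then obtain d :: real where d: "0 < d" "c - of_real d \<in> P"
    using archimedean_Positivstellensatz[OF preP archP, of c] by blast
  have "0 \<le> L (c - of_real d)" using d(2) L_growth by (simp add: P_def)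
  then show False using d(1) L(4) by (simp add: linear_diff[OF L(1)] linear_of_real[OF L(1)] L(2))
qed

end
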